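(* Let $f:H\to H$ be a quaternion-valued function of a quaternion variable $q$ which is (real, Fréchet) differentiable at a point $q\in H$, with differential $df$ at $q$. Then for every increment $dq=dq_a+dq_b\,i+dq_c\,j+dq_d\,k\in H$, $$df=\frac{\partial f}{\partial q}\,dq+\frac{\partial f}{\partial q^i}\,dq^i+\frac{\partial f}{\partial q^j}\,dq^j+\frac{\partial f}{\partial q^k}\,dq^k$$ and $$df=dq\,\frac{\partial^R f}{\partial q}+dq^i\,\frac{\partial^R f}{\partial q^i}+dq^j\,\frac{\partial^R f}{\partial q^j}+dq^k\,\frac{\partial^R f}{\partial q^k},$$ where all derivatives are evaluated at $q$ and $df=\frac{\partial f}{\partial q_a}dq_a+\frac{\partial f}{\partial q_b}dq_b+\frac{\partial f}{\partial q_c}dq_c+\frac{\partial f}{\partial q_d}dq_d$.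
   Context: $H$ denotes the real algebra of quaternions $q=q_a+q_bi+q_cj+q_dk$ ($q_a,q_b,q_c,q_d\in\mathbb{R}$). For $\nu\in\{i,j,k\}$ the involution of a quaternion $p$ is $p^\nu:=-\nu p\nu$; $dq^\nu$ denotes $(dq)^\nu$. A function $f:H\to H$ is viewed as a function of the four real variables $q_a,q_b,q_c,q_d$, with quaternion-valued partial derivatives. The left restricted HR derivatives are $$\tfrac{\partial f}{\partial q}:=\tfrac14\left(\tfrac{\partial f}{\partial q_a}-\tfrac{\partial f}{\partial q_b}i-\tfrac{\partial f}{\partial q_c}j-\tfrac{\partial f}{\partial q_d}k\right),\quad \tfrac{\partial f}{\partial q^i}:=\tfrac14\left(\tfrac{\partial f}{\partial q_a}-\tfrac{\partial f}{\partial q_b}i+\tfrac{\partial f}{\partial q_c}j+\tfrac{\partial f}{\partial q_d}k\right),$$ $$\tfrac{\partial f}{\partial q^j}:=\tfrac14\left(\tfrac{\partial f}{\partial q_a}+\tfrac{\partial f}{\partial q_b}i-\tfrac{\partial f}{\partial q_c}j+\tfrac{\partial f}{\partial q_d}k\right),\quad \tfrac{\partial f}{\partial q^k}:=\tfrac14\left(\tfrac{\partial f}{\partial q_a}+\tfrac{\partial f}{\partial q_b}i+\tfrac{\partial f}{\partial q_c}j-\tfrac{\partial f}{\partial q_d}k\right).$$ The right restricted HR derivatives $\frac{\partial^R f}{\partial q},\frac{\partial^R f}{\partial q^i},\frac{\partial^R f}{\partial q^j},\frac{\partial^R f}{\partial q^k}$ are given by the same four formulas with the units $i,j,k$ multiplying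 the partial derivatives from the left, e.g. $\frac{\partial^R f}{\partial q^i}:=\frac14\left(\frac{\partial f}{\partial q_a}-i\frac{\partial f}{\partial q_b}+j\frac{\partial f}{\partial q_c}+k\frac{\partial f}{\partial q_d}\right)$. *)

theory Defs
  imports "HOL-Analysis.Analysis"
begin

datatype quat = Quat (qa: real) (qb: real) (qc: real) (qd: real)

lemma quat_eq_iff:
  "x = y \<longleftrightarrow> qa x = qa y \<and> qb x = qb y \<and> qc x = qc y \<and> qd x = qd y"
  by (cases x; cases y) auto

instantiation quat :: real_vector
begin

definition zero_quat where "0 = Quat 0 0 0 0"
definition plus_quat where
  "x + y = Quat (qa x + qa y) (qb x + qb y) (qc x + qc y) (qd x + qd y)"
definition minus_quat where
  "x - y = Quat (qa x - qa y) (qb x - qb y) (qc x - qc y) (qd x - qd y)"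
definition uminus_quat where
  "- x = Quat (- qa x) (- qb x) (- qc x) (- qd x)"
definition scaleR_quat where
  "r *\<^sub>R x = Quat (r * qa x) (r * qb x) (r * qc x) (r * qd x)"

instance
  by standard
    (auto simp: quat_eq_iff zero_quat_def plus_quat_def minus_quat_def uminus_quat_def
      scaleR_quat_def algebra_simps)

end

instantiation quat :: real_algebra_1
begin

definition one_quat where "1 = Quat 1 0 0 0"
definition times_quat where
  "x * y = Quat
     (qa x * qa y - qb x * qb y - qc x * qc y - qd x * qd y)
     (qa x * qb y + qb x * qa y + qc x * qd y - qd x * qc y)
     (qa x * qc y - qb x * qd y + qc x * qa y + qd x * qb y)
     (qa x * qd y + qb x * qc y - qc x * qb y + qd x * qa y)"

instance
  by standard
    (auto simp: quat_eq_iff zero_quat_def plus_quat_def minus_quat_def uminus_quat_def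
      scaleR_quat_def one_quat_def times_quat_def algebra_simps)

end

lemma quat_sel [simp]:
  "qa 0 = 0" "qb 0 = 0" "qc 0 = 0" "qd 0 = 0"
  "qa 1 = 1" "qb 1 = 0" "qc 1 = 0" "qd 1 = 0"
  "qa (x + y) = qa x + qa y" "qb (x + y) = qb x + qb y"
  "qc (x + y) = qc x + qc y" "qd (x + y) = qd x + qd y"
  "qa (x - y) = qa x - qa y" "qb (x - y) = qb x - qb y"
  "qc (x - y) = qc x - qc y" "qd (x - y) = qd x - qd y"
  "qa (- x) = - qa x" "qb (- x) = - qb x" "qc (- x) = - qc x" "qd (- x) = - qd x"
  "qa (r *\<^sub>R x) = r * qa x" "qb (r *\<^sub>R x) = r * qb x"
  "qc (r *\<^sub>R x) = r * qc x" "qd (r *\<^sub>R x) = r * qd x"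
  by (simp_all add: zero_quat_def one_quat_def plus_quat_def minus_quat_def uminus_quat_def
      scaleR_quat_def)

lemma quat_sel_times:
  "qa (x * y) = qa x * qa y - qb x * qb y - qc x * qc y - qd x * qd y"
  "qb (x * y) = qa x * qb y + qb x * qa y + qc x * qd y - qd x * qc y"
  "qc (x * y) = qa x * qc y - qb x * qd y + qc x * qa y + qd x * qb y"
  "qd (x * y) = qa x * qd y + qb x * qc y - qc x * qb y + qd x * qa y"
  by (simp_all add: times_quat_def)

instantiation quat :: real_inner
begin

definition inner_quat where
  "inner x y = qa x * qa y + qb x * qb y + qc x * qc y + qd x * qd y"
definition norm_quat where "norm (x :: quat) = sqrt (inner x x)"
definition sgn_quat where "sgn (x :: quat) = x /\<^sub>R norm x"
definition dist_quat where "dist (x :: quat) y = norm (x - y)"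
definition uniformity_quat where
  "(uniformity :: (quat \<times> quat) filter) = (INF e\<in>{0 <..}. principal {(x, y). dist x y < e})"
definition open_quat where
  "open (U :: quat set) \<longleftrightarrow> (\<forall>x\<in>U. \<forall>\<^sub>F (x', y) in uniformity. x' = x \<longrightarrow> y \<in> U)"

instance
proof
  fix x y z :: quat and r :: real
  show "inner x y = inner y x"
    by (simp add: inner_quat_def mult.commute)
  show "inner (x + y) z = inner x z + inner y z" "inner (r *\<^sub>R x) y = r * inner x y"
    by (simp_all add: inner_quat_def algebra_simps)
  show "0 \<le> inner x x"
    by (simp add: inner_quat_def)
  show "inner x x = 0 \<longleftrightarrow> x = 0"
    by (simp add: inner_quat_def quat_eq_iff add_nonneg_eq_0_iff)
qed (simp_all add: norm_quat_def sgn_quat_def dist_quat_def uniformity_quat_def open_quat_def)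

end

definition quat_i :: quat where "quat_i = Quat 0 1 0 0"
definition quat_j :: quat where "quat_j = Quat 0 0 1 0"
definition quat_k :: quat where "quat_k = Quat 0 0 0 1"

lemma quat_units_mult:
  "quat_i * quat_i = -1" "quat_j * quat_j = -1" "quat_k * quat_k = -1"
  "quat_i * quat_j = quat_k" "quat_j * quat_k = quat_i" "quat_k * quat_i = quat_j"
  "quat_j * quat_i = - quat_k" "quat_k * quat_j = - quat_i" "quat_i * quat_k = - quat_j"
  by (simp_all add: quat_eq_iff quat_sel_times quat_i_def quat_j_def quat_k_def)

lemma quat_expand:
  "q = of_real (qa q) + of_real (qb q) * quat_i + of_real (qc q) * quat_j + of_real (qd q) * quat_k"
  by (simp add: quat_eq_iff quat_sel_times of_real_def quat_i_def quat_j_def quat_k_def)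

text \<open>An involution only when \<open>\<nu>\<close> is an imaginary unit; used for \<open>\<nu>\<close> among \<open>quat_i\<close>, \<open>quat_j\<close>, \<open>quat_k\<close>.\<close>
definition quat_invol :: "quat \<Rightarrow> quat \<Rightarrow> quat" where
  "quat_invol \<nu> p = - \<nu> * p * \<nu>"


definition partial_a :: "(quat \<Rightarrow> quat) \<Rightarrow> quat \<Rightarrow> quat" where
  "partial_a f q = vector_derivative (\<lambda>t. f (Quat t (qb q) (qc q) (qd q))) (at (qa q))"
definition partial_b :: "(quat \<Rightarrow> quat) \<Rightarrow> quat \<Rightarrow> quat" where
  "partial_b f q = vector_derivative (\<lambda>t. f (Quat (qa q) t (qc q) (qd q))) (at (qb q))"
definition partial_c :: "(quat \<Rightarrow> quat) \<Rightarrow> quat \<Rightarrow> quat" where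
  "partial_c f q = vector_derivative (\<lambda>t. f (Quat (qa q) (qb q) t (qd q))) (at (qc q))"
definition partial_d :: "(quat \<Rightarrow> quat) \<Rightarrow> quat \<Rightarrow> quat" where
  "partial_d f q = vector_derivative (\<lambda>t. f (Quat (qa q) (qb q) (qc q) t)) (at (qd q))"

definition HR_left :: "(quat \<Rightarrow> quat) \<Rightarrow> quat \<Rightarrow> quat" where
  "HR_left f q = (1/4) *\<^sub>R (partial_a f q - partial_b f q * quat_i
     - partial_c f q * quat_j - partial_d f q * quat_k)"
definition HR_left_i :: "(quat \<Rightarrow> quat) \<Rightarrow> quat \<Rightarrow> quat" where
  "HR_left_i f q = (1/4) *\<^sub>R (partial_a f q - partial_b f q * quat_i
     + partial_c f q * quat_j + partial_d f q * quat_k)"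
definition HR_left_j :: "(quat \<Rightarrow> quat) \<Rightarrow> quat \<Rightarrow> quat" where
  "HR_left_j f q = (1/4) *\<^sub>R (partial_a f q + partial_b f q * quat_i
     - partial_c f q * quat_j + partial_d f q * quat_k)"
definition HR_left_k :: "(quat \<Rightarrow> quat) \<Rightarrow> quat \<Rightarrow> quat" where
  "HR_left_k f q = (1/4) *\<^sub>R (partial_a f q + partial_b f q * quat_i
     + partial_c f q * quat_j - partial_d f q * quat_k)"

definition HR_right :: "(quat \<Rightarrow> quat) \<Rightarrow> quat \<Rightarrow> quat" where
  "HR_right f q = (1/4) *\<^sub>R (partial_a f q - quat_i * partial_b f q
     - quat_j * partial_c f q - quat_k * partial_d f q)"
definition HR_right_i :: "(quat \<Rightarrow> quat) \<Rightarrow> quat \<Rightarrow> quat" where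
  "HR_right_i f q = (1/4) *\<^sub>R (partial_a f q - quat_i * partial_b f q
     + quat_j * partial_c f q + quat_k * partial_d f q)"
definition HR_right_j :: "(quat \<Rightarrow> quat) \<Rightarrow> quat \<Rightarrow> quat" where
  "HR_right_j f q = (1/4) *\<^sub>R (partial_a f q + quat_i * partial_b f q
     - quat_j * partial_c f q + quat_k * partial_d f q)"
definition HR_right_k :: "(quat \<Rightarrow> quat) \<Rightarrow> quat \<Rightarrow> quat" where
  "HR_right_k f q = (1/4) *\<^sub>R (partial_a f q + quat_i * partial_b f q
     + quat_j * partial_c f q - quat_k * partial_d f q)"

end

theory Submission
  imports Defs
begin

text \<open>
  The first formula is linearity of the differential: each partial derivative is the value of
  \<open>df\<close> on the corresponding basis vector, because a coordinate line through \<open>q\<close> is an affine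
  curve with that velocity (\<open>vector_derivative_along_line\<close>).

  The two HR formulas are then pure quaternion algebra.  The involution \<open>p \<mapsto> p\<^sup>\<nu>\<close> keeps the real
  and \<open>\<nu>\<close> parts of \<open>p\<close> and negates the other two, so \<open>p, p\<^sup>i, p\<^sup>j, p\<^sup>k\<close> are signed sums of
  \<open>p\<^sub>a, p\<^sub>b i, p\<^sub>c j, p\<^sub>d k\<close>, with signs forming a symmetric 4 by 4 Hadamard matrix, whose square
  is 4 times the identity.  The HR derivatives apply the same sign matrix, divided by 4, to
  \<open>f\<^sub>a, - f\<^sub>b i, - f\<^sub>c j, - f\<^sub>d k\<close>.  Hence all mixed terms cancel in the sum of products, and what
  remains is \<open>f\<^sub>a p\<^sub>a - f\<^sub>b i (p\<^sub>b i) - f\<^sub>c j (p\<^sub>c j) - f\<^sub>d k (p\<^sub>d k)\<close>, where \<open>i\<^sup>2 = j\<^sup>2 = k\<^sup>2 = -1\<close>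
  removes the signs.  On the right side the units stand between the same factors in the opposite
  order, so the argument is unchanged (\<open>left_involution_expansion\<close>,
  \<open>right_involution_expansion\<close>).
\<close>

lemma vector_derivative_along_line:
  fixes f :: "'a::real_normed_vector \<Rightarrow> 'b::real_normed_vector"
  assumes "(f has_derivative df) (at q)"
  shows "vector_derivative (\<lambda>t. f (q + (t - s) *\<^sub>R v)) (at s) = df v"
proof -
  have line: "((\<lambda>t. q + (t - s) *\<^sub>R v) has_derivative (\<lambda>h. h *\<^sub>R v)) (at s)"
    by (auto intro!: derivative_eq_intros)
  have "(f has_derivative df) (at (q + (s - s) *\<^sub>R v))"
    using assms by simp
  from has_derivative_compose[OF line this]
  have "((\<lambda>t. f (q + (t - s) *\<^sub>R v)) has_derivative (\<lambda>h. df (h *\<^sub>R v))) (at s)" .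
  moreover have "df (h *\<^sub>R v) = h *\<^sub>R df v" for h
    by (rule linear_scale[OF has_derivative_linear[OF assms]])
  ultimately have "((\<lambda>t. f (q + (t - s) *\<^sub>R v)) has_vector_derivative df v) (at s)"
    by (simp add: has_vector_derivative_def)
  then show ?thesis
    by (rule vector_derivative_at)
qed

lemma partial_derivatives_eq_differential:
  assumes "(f has_derivative df) (at q)"
  shows "partial_a f q = df 1" "partial_b f q = df quat_i"
    "partial_c f q = df quat_j" "partial_d f q = df quat_k"
proof -
  have lines:
    "Quat t (qb q) (qc q) (qd q) = q + (t - qa q) *\<^sub>R 1"
    "Quat (qa q) t (qc q) (qd q) = q + (t - qb q) *\<^sub>R quat_i"
    "Quat (qa q) (qb q) t (qd q) = q + (t - qc q) *\<^sub>R quat_j"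
    "Quat (qa q) (qb q) (qc q) t = q + (t - qd q) *\<^sub>R quat_k" for t
    by (simp_all add: quat_eq_iff quat_i_def quat_j_def quat_k_def)
  show "partial_a f q = df 1" "partial_b f q = df quat_i"
    "partial_c f q = df quat_j" "partial_d f q = df quat_k"
    unfolding partial_a_def partial_b_def partial_c_def partial_d_def lines
    by (rule vector_derivative_along_line[OF assms])+
qed

lemma differential_eq_partial_derivatives:
  assumes "(f has_derivative df) (at q)"
  shows "df p = qa p *\<^sub>R partial_a f q + qb p *\<^sub>R partial_b f q
    + qc p *\<^sub>R partial_c f q + qd p *\<^sub>R partial_d f q"
proof -
  have lin: "linear df"
    by (rule has_derivative_linear[OF assms])
  have "p = qa p *\<^sub>R 1 + qb p *\<^sub>R quat_i + qc p *\<^sub>R quat_j + qd p *\<^sub>R quat_k"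
    by (simp add: quat_eq_iff quat_i_def quat_j_def quat_k_def)
  then have "df p = df (qa p *\<^sub>R 1 + qb p *\<^sub>R quat_i + qc p *\<^sub>R quat_j + qd p *\<^sub>R quat_k)"
    by (rule arg_cong)
  then show ?thesis
    by (simp add: partial_derivatives_eq_differential[OF assms]
        linear_add[OF lin] linear_scale[OF lin])
qed

lemma quat_invol_units:
  "quat_invol quat_i p = Quat (qa p) (qb p) (- qc p) (- qd p)"
  "quat_invol quat_j p = Quat (qa p) (- qb p) (qc p) (- qd p)"
  "quat_invol quat_k p = Quat (qa p) (- qb p) (- qc p) (qd p)"
  by (simp_all add: quat_invol_def quat_eq_iff quat_sel_times quat_i_def quat_j_def quat_k_def)

lemma left_involution_expansion:
  fixes A B C D p :: quat
  shows "(1/4) *\<^sub>R (A - B * quat_i - C * quat_j - D * quat_k) * p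
    + (1/4) *\<^sub>R (A - B * quat_i + C * quat_j + D * quat_k) * quat_invol quat_i p
    + (1/4) *\<^sub>R (A + B * quat_i - C * quat_j + D * quat_k) * quat_invol quat_j p
    + (1/4) *\<^sub>R (A + B * quat_i + C * quat_j - D * quat_k) * quat_invol quat_k p
    = qa p *\<^sub>R A + qb p *\<^sub>R B + qc p *\<^sub>R C + qd p *\<^sub>R D"
  unfolding quat_invol_units
  by (simp add: quat_eq_iff quat_sel_times quat_i_def quat_j_def quat_k_def algebra_simps)

lemma right_involution_expansion:
  fixes A B C D p :: quat
  shows "p * (1/4) *\<^sub>R (A - quat_i * B - quat_j * C - quat_k * D)
    + quat_invol quat_i p * (1/4) *\<^sub>R (A - quat_i * B + quat_j * C + quat_k * D)
    + quat_invol quat_j p * (1/4) *\<^sub>R (A + quat_i * B - quat_j * C + quat_k * D)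
    + quat_invol quat_k p * (1/4) *\<^sub>R (A + quat_i * B + quat_j * C - quat_k * D)
    = qa p *\<^sub>R A + qb p *\<^sub>R B + qc p *\<^sub>R C + qd p *\<^sub>R D"
  unfolding quat_invol_units
  by (simp add: quat_eq_iff quat_sel_times quat_i_def quat_j_def quat_k_def algebra_simps)

theorem mainTheorem6:
  fixes f df :: "quat \<Rightarrow> quat" and q :: quat
  assumes "(f has_derivative df) (at q)"
  shows "\<forall>dq :: quat.
      df dq = qa dq *\<^sub>R partial_a f q + qb dq *\<^sub>R partial_b f q
            + qc dq *\<^sub>R partial_c f q + qd dq *\<^sub>R partial_d f q \<and>
      df dq = HR_left f q * dq + HR_left_i f q * quat_invol quat_i dq
            + HR_left_j f q * quat_invol quat_j dq + HR_left_k f q * quat_invol quat_k dq \<and>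
      df dq = dq * HR_right f q + quat_invol quat_i dq * HR_right_i f q
            + quat_invol quat_j dq * HR_right_j f q + quat_invol quat_k dq * HR_right_k f q"
  unfolding HR_left_def HR_left_i_def HR_left_j_def HR_left_k_def
    HR_right_def HR_right_i_def HR_right_j_def HR_right_k_def
    left_involution_expansion right_involution_expansion
  using differential_eq_partial_derivatives[OF assms] by blast

end
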